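(* Let $v_0\in\mathbb{C}^n$ be a feasible solution of the zero-recourse AC-OPF problem $$\begin{aligned}\text{minimize}\quad & \sum_{i=1}^n\alpha_i\,v^H\left(\frac{S_i+S_i^H}{2}\right)v\\ \text{subject to}\quad & v\in\mathbb{C}^n,\\ & \gamma_i^{\min}-d_i\le v^HS_iv\le\gamma_i^{\max}-d_i,\quad i\in\mathcal{V},\\ & v_i^{\min}\le|v_i|\le v_i^{\max},\quad i\in\mathcal{V},\\ & -\ell_{ij}^{\max}\le v^HP_{ij}v\le\ell_{ij}^{\max},\quad (i,j)\in\mathcal{E},\end{aligned}$$ where $$\gamma_i^{\min}=\max_{\xi\in\Xi}\mathrm{Re}\{\underline{g}_i(\xi)\}+\mathbf{j}\max_{\xi\in\Xi}\mathrm{Im}\{\underline{g}_i(\xi)\},\qquad \gamma_i^{\max}=\min_{\xi\in\Xi}\mathrm{Re}\{\overline{g}_i(\xi)\}+\mathbf{j}\min_{\xi\in\Xi}\mathrm{Im}\{\overline{g}_i(\xi)\}.$$ Define $V_0=v_0e_1^T\in\mathbb{C}^{n\times k}$. Then the optimization problem $\mathcal{P}_{\rm III}(V_0)$, $$\begin{aligned}\text{minimize}\quad & \mathrm{Tr}(M H_0(V,V_0))\\ \text{subject to}\quad & x\in\mathbb{R}^{2n},\ V\in\mathbb{C}^{n\times k},\ \Lambda\in\mathbb{R}^{m\times \ell},\\ & H_i(V,V_0)-C_i+(b_i^Tx)e_1e_1^T-\sum_{j=1}^{\ell}[\Lambda]_{ij}W_j\preceq 0,\quad i=1,\dots,m,\\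 & Ex\le f,\quad \Lambda\le 0,\end{aligned}$$ has a nonempty feasible region.
   Context: Notation. $e_i$ is the $i$-th standard basis vector (dimension clear from context); $X^H$ is conjugate transpose and $X^T$ is transpose; $[X]_{ij}$ is the $(i,j)$ entry of $X$; $\mathrm{Tr}$ is the trace; $I_{2n}$ is the $2n\times 2n$ identity; $\mathbf{j}$ is the imaginary unit; $X\preceq 0$ ($X\succeq 0$) means Hermitian negative (positive) semidefinite; inequalities between real vectors or matrices (e.g. $\Lambda\le 0$, $Ex\le f$) are entrywise; for complex numbers, $z_1\le z_2$ means $\mathrm{Re}\,z_1\le\mathrm{Re}\,z_2$ and $\mathrm{Im}\,z_1\le \mathrm{Im}\,z_2$; $\mathrm{Re}$ and $\mathrm{Im}$ of vectors are entrywise. Uncertainty. $\boldsymbol{\xi}$ is a random vector in $\mathbb{R}^k$ with second-moment matrix $M=\mathbb{E}[\boldsymbol{\xi}\boldsymbol{\xi}^T]$, whose support is the nonempty compact set $\Xi=\{\xi\in\mathbb{R}^k: \xi_1=1,\ \xi^TW_j\xi\ge 0,\ j=1,\dots,\ell\}$, where $W_j=\begin{bmatrix}\omega_j & w_j^T\\ w_j & -\Omega_j^T\Omega_j\end{bmatrix}\in\mathbb{R}^{k\times k}$, $\omega_j\in\mathbb{R}$, $w_j\in\mathbb{R}^{k-1}$, $\Omega_j\in\mathbb{R}^{n_j\times(k-1)}$ for some natural number $n_j$. It is assumed that some $\xi\in\Xi$ satisfies $\xi^TW_j\xi>0$ for all $j=1,\dots,\ell$ (which implies that $M$ is positive definite).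 Network. $\mathcal{V}=\{1,\dots,n\}$ is the set of buses and $\mathcal{E}\subseteq\mathcal{V}\times\mathcal{V}$ the set of lines, with $(i,j)\in\mathcal{E}$ iff $(j,i)\in\mathcal{E}$. $Y\in\mathbb{C}^{n\times n}$ is the bus admittance matrix, $\widehat{y}_{ij}\in\mathbb{C}$ the total shunt admittance of line $(i,j)$. Set $S_i=Y^He_ie_i^T$, $\Phi_i=(S_i+S_i^H)/2$, $\Psi_i=(S_i-S_i^H)/(2\mathbf{j})$ for $i\in\mathcal{V}$, and for $(i,j)\in\mathcal{E}$, $S_{ij}=e_ie_i^T(\widehat{y}_{ij}/2-[Y]_{ij})^H+e_je_i^T[Y]_{ij}^H$, $P_{ij}=(S_{ij}+S_{ij}^H)/2$. Parameters. For each bus $i$: marginal cost $\alpha_i\ge 0$, demand $d_i\in\mathbb{C}$, nameplate minimum and maximum generation capacities $g_i^{\min},g_i^{\max}\in\mathbb{C}$ (stacked into vectors $g^{\min},g^{\max}$), ramp-down and ramp-up limits $r_i^{\min},r_i^{\max}\in\mathbb{C}$, lower and upper voltage magnitude limits $v_i^{\min},v_i^{\max}\in\mathbb{R}$; for each line $(i,j)$, active power flow capacity $\ell_{ij}^{\max}\in\mathbb{R}$. Real-time capacity bounds are $\underline{g}(\xi)=\underline{G}\xi$, $\overline{g}(\xi)=\overline{G}\xi$ with $\underline{G},\overline{G}\in\mathbb{C}^{n\times k}$, and $g_i^{\min}\le\underline{g}_i(\xi)\le\overline{g}_i(\xi)\le g_i^{\max}$ for all $\xi\in\Xi$, $i\in\mathcal{V}$.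 Problem data. $A_0=\sum_{i=1}^n\alpha_i\Phi_i$. With $m=10n+2|\mathcal{E}|$, the triples $(A_i,b_i,c_i)$, $i=1,\dots,m$, with $A_i\in\mathbb{C}^{n\times n}$ Hermitian, $b_i\in\mathbb{R}^{2n}$, $c_i\in\mathbb{R}^k$, enumerate the following: for every $i\in\mathcal{V}$, the ten triples $(\Phi_i,\,0,\,\mathrm{Re}\{\overline{G}^Te_i-d_ie_1\})$, $(-\Phi_i,\,0,\,\mathrm{Re}\{d_ie_1-\underline{G}^Te_i\})$, $(\Psi_i,\,0,\,\mathrm{Im}\{\overline{G}^Te_i-d_ie_1\})$, $(-\Psi_i,\,0,\,\mathrm{Im}\{d_ie_1-\underline{G}^Te_i\})$, $(\Phi_i,\,-e_i,\,\mathrm{Re}\{r_i^{\max}-d_i\}e_1)$, $(-\Phi_i,\,e_i,\,\mathrm{Re}\{d_i-r_i^{\min}\}e_1)$, $(\Psi_i,\,-e_{n+i},\,\mathrm{Im}\{r_i^{\max}-d_i\}e_1)$, $(-\Psi_i,\,e_{n+i},\,\mathrm{Im}\{d_i-r_i^{\min}\}e_1)$, $(e_ie_i^T,\,0,\,(v_i^{\max})^2e_1)$, $(-e_ie_i^T,\,0,\,-(v_i^{\min})^2e_1)$; and for every $(i,j)\in\mathcal{E}$, the two triples $(P_{ij},\,0,\,\ell_{ij}^{\max}e_1)$, $(-P_{ij},\,0,\,\ell_{ij}^{\max}e_1)$. Also $E=\begin{bmatrix}I_{2n}&-I_{2n}\end{bmatrix}^T\in\mathbb{R}^{4n\times 2n}$,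 $f=[\mathrm{Re}\{g^{\max}\}^T,\ \mathrm{Im}\{g^{\max}\}^T,\ -\mathrm{Re}\{g^{\min}\}^T,\ -\mathrm{Im}\{g^{\min}\}^T]^T\in\mathbb{R}^{4n}$, and $C_i=(e_1c_i^T+c_ie_1^T)/2$. Majorizers. For $i=0,1,\dots,m$, write $A_i=A_i^++A_i^-$ with $A_i^+\succeq0$ and $A_i^-\preceq0$ the positive and negative semidefinite parts of $A_i$, and for $V,Z\in\mathbb{C}^{n\times k}$ let $H_i(V,Z)=V^HA_i^+V+Z^HA_i^-V+V^HA_i^-Z-Z^HA_i^-Z$.
   Formalization: The formal statement additionally assumes that the ramp limits satisfy r_i^min ≤ 0 ≤ r_i^max (real and imaginary parts) and that the lower voltage magnitude limits satisfy v_i^min ≥ 0; without either condition the claim fails. *)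

theory Defs
  imports "HOL-Probability.Probability" "HOL-Library.Multiset"
begin

section \<open>Complex matrices and vectors\<close>

text \<open>Complex numbers are ordered componentwise; this is not the order of
  \<open>Complex_Order\<close>, which requires equal imaginary parts.\<close>

definition complex_le :: "complex \<Rightarrow> complex \<Rightarrow> bool" (infix "\<le>\<^sub>C" 50) where
  "z \<le>\<^sub>C w \<longleftrightarrow> Re z \<le> Re w \<and> Im z \<le> Im w"

definition Re_vec :: "complex ^ 'n \<Rightarrow> real ^ 'n" where
  "Re_vec z = (\<chi> i. Re (z $ i))"

definition Im_vec :: "complex ^ 'n \<Rightarrow> real ^ 'n" where
  "Im_vec z = (\<chi> i. Im (z $ i))"

definition complex_vec :: "real ^ 'n \<Rightarrow> complex ^ 'n" where
  "complex_vec x = (\<chi> i. complex_of_real (x $ i))"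

definition complex_mat :: "real ^ 'n ^ 'm \<Rightarrow> complex ^ 'n ^ 'm" where
  "complex_mat X = (\<chi> i j. complex_of_real (X $ i $ j))"

definition ctranspose :: "complex ^ 'n ^ 'm \<Rightarrow> complex ^ 'm ^ 'n" where
  "ctranspose X = (\<chi> i j. cnj (X $ j $ i))"

text \<open>\<open>outer u v\<close> is $u v^T$, without conjugation.\<close>

definition outer :: "'a::times ^ 'm \<Rightarrow> 'a ^ 'n \<Rightarrow> 'a ^ 'n ^ 'm" where
  "outer u v = (\<chi> i j. u $ i * v $ j)"

text \<open>\<open>quad_form v X\<close> is $v^H X v$.\<close>

definition quad_form :: "complex ^ 'n \<Rightarrow> complex ^ 'n ^ 'n \<Rightarrow> complex" where
  "quad_form v X = (\<Sum>i\<in>UNIV. cnj (v $ i) * (X *v v) $ i)"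

definition hermitian :: "complex ^ 'n ^ 'n \<Rightarrow> bool" where
  "hermitian X \<longleftrightarrow> ctranspose X = X"

definition psd :: "complex ^ 'n ^ 'n \<Rightarrow> bool" where
  "psd X \<longleftrightarrow> hermitian X \<and> (\<forall>v. 0 \<le> Re (quad_form v X))"

definition nsd :: "complex ^ 'n ^ 'n \<Rightarrow> bool" where
  "nsd X \<longleftrightarrow> hermitian X \<and> (\<forall>v. Re (quad_form v X) \<le> 0)"

text \<open>A splitting of a Hermitian matrix into a positive and a negative semidefinite summand
  is not unique; the two summands are the (spectral) positive and negative parts exactly when
  their product vanishes.\<close>

definition semidef_parts ::
  "complex ^ 'n ^ 'n \<Rightarrow> complex ^ 'n ^ 'n \<Rightarrow> complex ^ 'n ^ 'n \<Rightarrow> bool" where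
  "semidef_parts A Apos Aneg \<longleftrightarrow>
     A = Apos + Aneg \<and> psd Apos \<and> nsd Aneg \<and> Apos ** Aneg = 0"

section \<open>Optimization problems\<close>

record 'a minimization =
  objective :: "'a \<Rightarrow> real"
  feasible_region :: "'a set"

section \<open>Uncertainty\<close>

definition rv_support :: "'w measure \<Rightarrow> ('w \<Rightarrow> real ^ 'k) \<Rightarrow> (real ^ 'k) set" where
  "rv_support \<mu> X = {x. \<forall>U. open U \<and> x \<in> U \<longrightarrow> 0 < measure (distr \<mu> borel X) U}"

definition second_moment :: "'w measure \<Rightarrow> ('w \<Rightarrow> real ^ 'k) \<Rightarrow> real ^ 'k ^ 'k" where
  "second_moment \<mu> X = (\<chi> p q. LINT \<omega>|\<mu>. X \<omega> $ p * X \<omega> $ q)"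

text \<open>The index type \<open>'k\<close> of $\mathbb{R}^k$ has a distinguished element \<open>one\<close>, the first
  coordinate; the remaining \<open>k - 1\<close> coordinates are the indices different from \<open>one\<close>.
  In the block matrix below, \<open>w\<close> and the rows \<open>\<Omega> 1, \<dots>, \<Omega> N\<close> of $\Omega$ stand
  for vectors in $\mathbb{R}^{k-1}$: their entries at \<open>one\<close> are never used.\<close>

definition ellipsoid_matrix ::
  "'k \<Rightarrow> real \<Rightarrow> real ^ 'k \<Rightarrow> nat \<Rightarrow> (nat \<Rightarrow> real ^ 'k) \<Rightarrow> real ^ 'k ^ 'k" where
  "ellipsoid_matrix one \<omega> w N \<Omega> =
     (\<chi> p q. if p = one \<and> q = one then \<omega>
            else if p = one then w $ q
            else if q = one then w $ p
            else - (\<Sum>r\<in>{1..N}. \<Omega> r $ p * \<Omega> r $ q))"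

definition uncertainty_set :: "'k \<Rightarrow> nat \<Rightarrow> (nat \<Rightarrow> real ^ 'k ^ 'k) \<Rightarrow> (real ^ 'k) set" where
  "uncertainty_set one l W = {\<xi>. \<xi> $ one = 1 \<and> (\<forall>j\<in>{1..l}. 0 \<le> \<xi> \<bullet> (W j *v \<xi>))}"

section \<open>Network\<close>

definition S_bus :: "complex ^ 'n ^ 'n \<Rightarrow> 'n \<Rightarrow> complex ^ 'n ^ 'n" where
  "S_bus Y i = ctranspose Y ** outer (axis i 1) (axis i 1)"

definition herm_part :: "complex ^ 'n ^ 'n \<Rightarrow> complex ^ 'n ^ 'n" where
  "herm_part S = (\<chi> p q. (S $ p $ q + ctranspose S $ p $ q) / 2)"

definition skew_part :: "complex ^ 'n ^ 'n \<Rightarrow> complex ^ 'n ^ 'n" where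
  "skew_part S = (\<chi> p q. (S $ p $ q - ctranspose S $ p $ q) / (2 * \<i>))"

definition Phi :: "complex ^ 'n ^ 'n \<Rightarrow> 'n \<Rightarrow> complex ^ 'n ^ 'n" where
  "Phi Y i = herm_part (S_bus Y i)"

definition Psi :: "complex ^ 'n ^ 'n \<Rightarrow> 'n \<Rightarrow> complex ^ 'n ^ 'n" where
  "Psi Y i = skew_part (S_bus Y i)"

definition S_line ::
  "complex ^ 'n ^ 'n \<Rightarrow> ('n \<Rightarrow> 'n \<Rightarrow> complex) \<Rightarrow> 'n \<Rightarrow> 'n \<Rightarrow> complex ^ 'n ^ 'n" where
  "S_line Y yhat i j =
     (\<chi> p q. outer (axis i 1) (axis i 1) $ p $ q * cnj (yhat i j / 2 - Y $ i $ j)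
           + outer (axis j 1) (axis i 1) $ p $ q * cnj (Y $ i $ j))"

definition P_line ::
  "complex ^ 'n ^ 'n \<Rightarrow> ('n \<Rightarrow> 'n \<Rightarrow> complex) \<Rightarrow> 'n \<Rightarrow> 'n \<Rightarrow> complex ^ 'n ^ 'n" where
  "P_line Y yhat i j = herm_part (S_line Y yhat i j)"

section \<open>Zero-recourse AC-OPF\<close>

text \<open>Here \<open>Glow\<close> and \<open>Gup\<close> are $\underline{G}$ and $\overline{G}$. Suprema and infima over
  the nonempty compact set \<open>\<Xi>\<close> are attained.\<close>

definition gen_bound :: "complex ^ 'k ^ 'n \<Rightarrow> real ^ 'k \<Rightarrow> complex ^ 'n" where
  "gen_bound G \<xi> = G *v complex_vec \<xi>"

definition gamma_min :: "(real ^ 'k) set \<Rightarrow> complex ^ 'k ^ 'n \<Rightarrow> 'n \<Rightarrow> complex" where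
  "gamma_min \<Xi> Glow i =
     Complex (SUP \<xi>\<in>\<Xi>. Re (gen_bound Glow \<xi> $ i)) (SUP \<xi>\<in>\<Xi>. Im (gen_bound Glow \<xi> $ i))"

definition gamma_max :: "(real ^ 'k) set \<Rightarrow> complex ^ 'k ^ 'n \<Rightarrow> 'n \<Rightarrow> complex" where
  "gamma_max \<Xi> Gup i =
     Complex (INF \<xi>\<in>\<Xi>. Re (gen_bound Gup \<xi> $ i)) (INF \<xi>\<in>\<Xi>. Im (gen_bound Gup \<xi> $ i))"

text \<open>In both objectives below, \<open>Re\<close> only converts the type: quadratic forms of
  Hermitian matrices and traces of products of two Hermitian matrices are real.\<close>

definition zero_recourse ::
  "complex ^ 'n ^ 'n \<Rightarrow> ('n \<Rightarrow> 'n \<Rightarrow> complex) \<Rightarrow> ('n \<times> 'n) set \<Rightarrow> real ^ 'n \<Rightarrow> complex ^ 'n \<Rightarrow>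
   ('n \<Rightarrow> complex) \<Rightarrow> ('n \<Rightarrow> complex) \<Rightarrow> real ^ 'n \<Rightarrow> real ^ 'n \<Rightarrow> ('n \<Rightarrow> 'n \<Rightarrow> real) \<Rightarrow>
   (complex ^ 'n) minimization" where
  "zero_recourse Y yhat Lines \<alpha> d \<gamma>min \<gamma>max vmin vmax lmax =
     \<lparr> objective = (\<lambda>v. \<Sum>i\<in>UNIV. \<alpha> $ i * Re (quad_form v (herm_part (S_bus Y i)))),
       feasible_region = {v.
         (\<forall>i. \<gamma>min i - d $ i \<le>\<^sub>C quad_form v (S_bus Y i) \<and>
              quad_form v (S_bus Y i) \<le>\<^sub>C \<gamma>max i - d $ i) \<and>
         (\<forall>i. vmin $ i \<le> cmod (v $ i) \<and> cmod (v $ i) \<le> vmax $ i) \<and>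
         (\<forall>(i, j)\<in>Lines. - complex_of_real (lmax i j) \<le>\<^sub>C quad_form v (P_line Y yhat i j) \<and>
              quad_form v (P_line Y yhat i j) \<le>\<^sub>C complex_of_real (lmax i j))} \<rparr>"

section \<open>Data of the inner approximation\<close>

text \<open>Vectors in $\mathbb{R}^{2n}$ are indexed by \<open>'n + 'n\<close>, so that $e_i$ and $e_{n+i}$ are the
  unit vectors at \<open>Inl i\<close> and \<open>Inr i\<close>; similarly for $\mathbb{R}^{4n}$.\<close>

definition bus_triples ::
  "'k \<Rightarrow> complex ^ 'n ^ 'n \<Rightarrow> complex ^ 'n \<Rightarrow> complex ^ 'k ^ 'n \<Rightarrow> complex ^ 'k ^ 'n \<Rightarrow>
   complex ^ 'n \<Rightarrow> complex ^ 'n \<Rightarrow> real ^ 'n \<Rightarrow> real ^ 'n \<Rightarrow> 'n \<Rightarrow>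
   ((complex ^ 'n ^ 'n) \<times> (real ^ ('n + 'n)) \<times> (real ^ 'k)) multiset" where
  "bus_triples one Y d Glow Gup rmin rmax vmin vmax i =
    {# (Phi Y i, 0, Re_vec (transpose Gup *v axis i 1 - d $ i *s axis one 1)),
       (- Phi Y i, 0, Re_vec (d $ i *s axis one 1 - transpose Glow *v axis i 1)),
       (Psi Y i, 0, Im_vec (transpose Gup *v axis i 1 - d $ i *s axis one 1)),
       (- Psi Y i, 0, Im_vec (d $ i *s axis one 1 - transpose Glow *v axis i 1)),
       (Phi Y i, - axis (Inl i) 1, Re (rmax $ i - d $ i) *s axis one 1),
       (- Phi Y i, axis (Inl i) 1, Re (d $ i - rmin $ i) *s axis one 1),
       (Psi Y i, - axis (Inr i) 1, Im (rmax $ i - d $ i) *s axis one 1),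
       (- Psi Y i, axis (Inr i) 1, Im (d $ i - rmin $ i) *s axis one 1),
       (outer (axis i 1) (axis i 1), 0, (vmax $ i)\<^sup>2 *s axis one 1),
       (- outer (axis i 1) (axis i 1), 0, - (vmin $ i)\<^sup>2 *s axis one 1) #}"

definition line_triples ::
  "'k \<Rightarrow> complex ^ 'n ^ 'n \<Rightarrow> ('n \<Rightarrow> 'n \<Rightarrow> complex) \<Rightarrow> ('n \<Rightarrow> 'n \<Rightarrow> real) \<Rightarrow> 'n \<Rightarrow> 'n \<Rightarrow>
   ((complex ^ 'n ^ 'n) \<times> (real ^ ('n + 'n)) \<times> (real ^ 'k)) multiset" where
  "line_triples one Y yhat lmax i j =
    {# (P_line Y yhat i j, 0, lmax i j *s axis one 1),
       (- P_line Y yhat i j, 0, lmax i j *s axis one 1) #}"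

definition E_mat :: "real ^ ('n::finite + 'n) ^ (('n + 'n) + ('n + 'n))" where
  "E_mat = (\<chi> r. case r of Inl p \<Rightarrow> axis p 1 | Inr p \<Rightarrow> - axis p 1)"

definition f_vec :: "complex ^ 'n \<Rightarrow> complex ^ 'n \<Rightarrow> real ^ (('n + 'n) + ('n + 'n))" where
  "f_vec gmin gmax =
     (\<chi> r. case r of
          Inl (Inl i) \<Rightarrow> Re (gmax $ i) | Inl (Inr i) \<Rightarrow> Im (gmax $ i)
        | Inr (Inl i) \<Rightarrow> - Re (gmin $ i) | Inr (Inr i) \<Rightarrow> - Im (gmin $ i))"

definition C_mat :: "'k \<Rightarrow> real ^ 'k \<Rightarrow> real ^ 'k ^ 'k" where
  "C_mat one c = (1/2) *\<^sub>R (outer (axis one 1) c + outer c (axis one 1))"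

definition majorizer ::
  "complex ^ 'n ^ 'n \<Rightarrow> complex ^ 'n ^ 'n \<Rightarrow> complex ^ 'k ^ 'n \<Rightarrow> complex ^ 'k ^ 'n \<Rightarrow>
   complex ^ 'k ^ 'k" where
  "majorizer Apos Aneg V Z =
     ctranspose V ** Apos ** V + ctranspose Z ** Aneg ** V
     + ctranspose V ** Aneg ** Z - ctranspose Z ** Aneg ** Z"

text \<open>The decision variables are triples $(x, V, \Lambda)$. An $m \times \ell$ matrix is
  represented by a function of two indices, starting at 1, that vanishes outside
  $\{1,\dots,m\} \times \{1,\dots,\ell\}$.\<close>

definition P_III ::
  "'k \<Rightarrow> nat \<Rightarrow> nat \<Rightarrow> real ^ 'k ^ 'k \<Rightarrow> (nat \<Rightarrow> real ^ 'k ^ 'k) \<Rightarrow>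
   (nat \<Rightarrow> complex ^ 'n ^ 'n) \<Rightarrow> (nat \<Rightarrow> complex ^ 'n ^ 'n) \<Rightarrow>
   (nat \<Rightarrow> real ^ ('n + 'n)) \<Rightarrow> (nat \<Rightarrow> real ^ 'k) \<Rightarrow> complex ^ 'n \<Rightarrow> complex ^ 'n \<Rightarrow>
   complex ^ 'k ^ 'n \<Rightarrow>
   ((real ^ ('n + 'n)) \<times> (complex ^ 'k ^ 'n) \<times> (nat \<Rightarrow> nat \<Rightarrow> real)) minimization" where
  "P_III one m l M W Apos Aneg b c gmin gmax V\<^sub>0 =
     \<lparr> objective = (\<lambda>(x, V, \<Lambda>). Re (trace (complex_mat M ** majorizer (Apos 0) (Aneg 0) V V\<^sub>0))),
       feasible_region = {(x, V, \<Lambda>).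
         (\<forall>i j. \<not> (i \<in> {1..m} \<and> j \<in> {1..l}) \<longrightarrow> \<Lambda> i j = 0) \<and>
         (\<forall>i\<in>{1..m}.
            nsd (majorizer (Apos i) (Aneg i) V V\<^sub>0
                 + complex_mat (- C_mat one (c i)
                                + (b i \<bullet> x) *\<^sub>R outer (axis one 1) (axis one 1)
                                - (\<Sum>j\<in>{1..l}. \<Lambda> i j *\<^sub>R W j)))) \<and>
         E_mat *v x \<le> f_vec gmin gmax \<and>
         (\<forall>i\<in>{1..m}. \<forall>j\<in>{1..l}. \<Lambda> i j \<le> 0)} \<rparr>"

end

theory Submission
  imports Defs
begin

text \<open>
  The feasible point is the deterministic policy of operating at \<open>v\<^sub>0\<close> whatever happens: the
  voltage policy is $V = V_0$, and \<open>x\<close> is the power injected at \<open>v\<^sub>0\<close> plus the demand, that is,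
  the generation which \<open>v\<^sub>0\<close> requires (\<open>generation\<close>).

  At $V = V_0$ the majorizer is tight: $H_i(V_0, V_0) = V_0^H A_i V_0 =
  (v_0^H A_i v_0) e_1 e_1^T$ (\<open>majorizer_outer_axis\<close>). All that remains of the $i$-th matrix
  inequality is a real symmetric matrix, the homogenization of
  $v_0^H A_i v_0 + b_i^T x - c_i^T \xi - \sum_j \Lambda_{ij}\, \xi^T W_j \xi$. Choosing the
  multipliers in \<open>\<Lambda>\<close> is therefore a Lagrange duality question: an affine function that is
  nonnegative on the convex set \<open>\<Xi>\<close> must dominate a nonnegative combination of the concave
  functions $\xi^T W_j \xi$ on the hyperplane $\xi_1 = 1$. The Slater point makes this duality
  exact (\<open>lagrange_multipliers\<close>, \<open>affine_s_procedure\<close>), so that the matrix inequality only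
  requires $v_0^H A_i v_0 + b_i^T x \le c_i^T \xi$ for all \<open>\<xi> \<in> \<Xi>\<close>
  (\<open>lmi_from_uncertainty_bound\<close>).

  These scalar inequalities are the original network constraints (\<open>bus_triples_bound\<close>,
  \<open>line_triples_bound\<close>). The capacity constraints hold for every \<open>\<xi>\<close> because
  $\gamma_i^{\min}$ and $\gamma_i^{\max}$ are the worst cases over \<open>\<Xi>\<close>; the
  choice of \<open>x\<close> cancels the injection in the ramping constraints, which become
  $r_i^{\min} \le 0 \le r_i^{\max}$; voltage and flow limits do not involve \<open>\<xi>\<close>. The same worst-case bounds at one point of \<open>\<Xi>\<close> give $Ex \le f$.
\<close>

section \<open>Lagrange multipliers\<close>

text \<open>The multiplier must be at most \<open>f x / g x\<close> where \<open>g x > 0\<close> and at least \<open>f y / g y\<close>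
  where \<open>g y < 0\<close>, so the infimum of the first family of ratios is the candidate; the Slater
  point makes that family nonempty. The two requirements are compatible since
  otherwise the segment from \<open>x\<close> to \<open>y\<close> would contain a point with \<open>g \<ge> 0\<close> and \<open>f < 0\<close>.\<close>

lemma single_lagrange_multiplier:
  fixes f g :: "'a::real_vector \<Rightarrow> real"
  assumes f: "convex_on D f" and g: "concave_on D g"
    and z: "z \<in> D" "0 < g z"
    and nonneg: "\<And>x. x \<in> D \<Longrightarrow> 0 \<le> g x \<Longrightarrow> 0 \<le> f x"
  shows "\<exists>\<nu>\<ge>0. \<forall>x\<in>D. \<nu> * g x \<le> f x"
proof -
  define Q where "Q = (\<lambda>x. f x / g x) ` {x\<in>D. 0 < g x}"
  have Q: "Q \<noteq> {}" "\<And>r. r \<in> Q \<Longrightarrow> 0 \<le> r"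
    using z nonneg by (auto simp: Q_def)
  then have bdd: "bdd_below Q" by (meson bdd_belowI)
  have "Inf Q * g y \<le> f y" if y: "y \<in> D" for y
  proof (cases "g y" "0::real" rule: linorder_cases)
    case less
    have "f y / g y \<le> r" if r: "r \<in> Q" for r
    proof -
      obtain x where x: "x \<in> D" "0 < g x" "r = f x / g x"
        using r by (auto simp: Q_def)
      \<comment> \<open>The point of the segment from \<open>y\<close> to \<open>x\<close> at which the affine interpolation of
        \<open>g\<close> vanishes; concavity puts it in the region where \<open>f\<close> is nonnegative.\<close>
      define t where "t = g x / (g x - g y)"
      have t: "0 \<le> t" "t \<le> 1" "t * g y + (1 - t) * g x = 0"
        using x less by (auto simp: t_def divide_simps)
      define p where "p = (1 - t) *\<^sub>R x + t *\<^sub>R y"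
      have "p \<in> D"
        unfolding p_def using convex_on_imp_convex[OF f] x(1) y t
        by (simp add: convexD_alt)
      moreover have "(1 - t) * g x + t * g y \<le> g p"
        unfolding p_def using concave_onD[OF g t(1,2) x(1) y] .
      ultimately have "0 \<le> f p"
        using t(3) nonneg by simp
      also have "f p \<le> (1 - t) * f x + t * f y"
        unfolding p_def using convex_onD[OF f t(1,2) x(1) y] .
      finally have "0 \<le> (g x - g y) * ((1 - t) * f x + t * f y)"
        using x less by simp
      moreover have "(g x - g y) * t = g x"
        using x less by (simp add: t_def)
      moreover have "(g x - g y) * ((1 - t) * f x + t * f y) =
          (g x - g y) * f x + (g x - g y) * t * (f y - f x)"
        by (simp add: algebra_simps)
      ultimately have "g y * f x \<le> g x * f y" by (simp add: algebra_simps)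
      then show ?thesis
        unfolding x(3) using x(2) less by (simp add: field_simps)
    qed
    then have "f y / g y \<le> Inf Q"
      using Q(1) by (intro cInf_greatest) auto
    then show ?thesis
      using less by (simp add: field_simps)
  next
    case equal
    then show ?thesis using nonneg[OF y] by simp
  next
    case greater
    then have "Inf Q \<le> f y / g y"
      using y bdd by (intro cInf_lower) (auto simp: Q_def)
    then show ?thesis
      using greater by (simp add: field_simps)
  qed
  moreover have "0 \<le> Inf Q"
    using Q by (intro cInf_greatest) auto
  ultimately show ?thesis by blast
qed

text \<open>Pricing out one constraint replaces \<open>f\<close> by \<open>f - \<kappa> g\<close>, which is again convex, so the
  constraints can be removed one after the other without any separation argument in a space
  of dimension \<open>card J\<close>.\<close>

lemma lagrange_multipliers:
  fixes f :: "'a::real_vector \<Rightarrow> real" and g :: "'b \<Rightarrow> 'a \<Rightarrow> real"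
  assumes "finite J"
    and f: "convex_on D f" and g: "\<And>j. j \<in> J \<Longrightarrow> concave_on D (g j)"
    and z: "z \<in> D" "\<And>j. j \<in> J \<Longrightarrow> 0 < g j z"
    and nonneg: "\<And>x. x \<in> D \<Longrightarrow> (\<And>j. j \<in> J \<Longrightarrow> 0 \<le> g j x) \<Longrightarrow> 0 \<le> f x"
  shows "\<exists>\<nu>. (\<forall>j\<in>J. 0 \<le> \<nu> j) \<and> (\<forall>x\<in>D. (\<Sum>j\<in>J. \<nu> j * g j x) \<le> f x)"
  using assms(1) f g z(2) nonneg
proof (induction J arbitrary: f)
  case empty
  then show ?case by auto
next
  case (insert a J)
  \<comment> \<open>The region cut out by the other constraints is itself convex, so that the constraint
    \<open>a\<close> can be priced out over it alone.\<close>
  define D' where "D' = {x\<in>D. \<forall>j\<in>J. 0 \<le> g j x}"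
  have "convex D'"
  proof (rule convexI)
    fix x y and s t :: real
    assume *: "x \<in> D'" "y \<in> D'" "0 \<le> s" "0 \<le> t" "s + t = 1"
    have "0 \<le> g j (s *\<^sub>R x + t *\<^sub>R y)" if "j \<in> J" for j
    proof -
      have s: "s = 1 - t" using * by simp
      have "0 \<le> s * g j x + t * g j y" using * that by (auto simp: D'_def)
      also have "\<dots> \<le> g j (s *\<^sub>R x + t *\<^sub>R y)"
        using concave_onD[OF insert.prems(2), of j t x y] * that
        unfolding s by (auto simp: D'_def)
      finally show ?thesis .
    qed
    then show "s *\<^sub>R x + t *\<^sub>R y \<in> D'"
      using * convex_on_imp_convex[OF insert.prems(1)] by (auto simp: D'_def convexD)
  qed
  have sub: "D' \<subseteq> D" by (auto simp: D'_def)
  have "\<exists>\<nu>\<ge>0. \<forall>x\<in>D'. \<nu> * g a x \<le> f x"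
  proof (rule single_lagrange_multiplier)
    show "convex_on D' f"
      using insert.prems(1) sub \<open>convex D'\<close> by (rule convex_on_subset)
    show "concave_on D' (g a)"
      using insert.prems(2)[of a] sub \<open>convex D'\<close>
      unfolding concave_on_def by (auto intro: convex_on_subset)
    show "z \<in> D'" "0 < g a z"
      using insert.prems(3) z(1) by (auto simp: D'_def intro: less_imp_le)
    show "0 \<le> f x" if "x \<in> D'" "0 \<le> g a x" for x
      using insert.prems(4)[of x] that by (auto simp: D'_def)
  qed
  then obtain \<kappa> where \<kappa>: "0 \<le> \<kappa>" "\<And>x. x \<in> D' \<Longrightarrow> \<kappa> * g a x \<le> f x"
    by blast
  have "\<exists>\<nu>. (\<forall>j\<in>J. 0 \<le> \<nu> j) \<and> (\<forall>x\<in>D. (\<Sum>j\<in>J. \<nu> j * g j x) \<le> f x - \<kappa> * g a x)"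
  proof (rule insert.IH)
    have "convex_on D (\<lambda>x. \<kappa> * - g a x)"
      using insert.prems(2)[of a] \<kappa>(1) by (intro convex_on_cmul) (auto simp: concave_on_def)
    from convex_on_add[OF insert.prems(1) this]
    show "convex_on D (\<lambda>x. f x - \<kappa> * g a x)" by simp
    show "concave_on D (g j)" "0 < g j z" if "j \<in> J" for j
      using insert.prems(2,3) that by auto
    show "0 \<le> f x - \<kappa> * g a x" if "x \<in> D" "\<And>j. j \<in> J \<Longrightarrow> 0 \<le> g j x" for x
      using \<kappa>(2)[of x] that by (auto simp: D'_def)
  qed
  then obtain \<nu> where \<nu>: "\<forall>j\<in>J. 0 \<le> \<nu> j"
      "\<forall>x\<in>D. (\<Sum>j\<in>J. \<nu> j * g j x) \<le> f x - \<kappa> * g a x" by blast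
  have "(\<Sum>j\<in>insert a J. (\<nu>(a := \<kappa>)) j * g j x) = \<kappa> * g a x + (\<Sum>j\<in>J. \<nu> j * g j x)" for x
  proof -
    have "(\<Sum>j\<in>J. (\<nu>(a := \<kappa>)) j * g j x) = (\<Sum>j\<in>J. \<nu> j * g j x)"
      using insert.hyps by (intro sum.cong) auto
    then show ?thesis using insert.hyps by simp
  qed
  then have "(\<forall>j\<in>insert a J. 0 \<le> (\<nu>(a := \<kappa>)) j) \<and>
      (\<forall>x\<in>D. (\<Sum>j\<in>insert a J. (\<nu>(a := \<kappa>)) j * g j x) \<le> f x)"
    using \<nu> \<kappa>(1) by (auto simp: algebra_simps)
  then show ?case by blast
qed

section \<open>The S-procedure on the hyperplane of vectors with first coordinate one\<close>

lemma quadratic_form_scaleR: "(t *\<^sub>R u) \<bullet> (W *v (t *\<^sub>R u)) = t\<^sup>2 * (u \<bullet> (W *v u))"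
  for u :: "real ^ 'k"
  by (simp add: matrix_vector_mult_scaleR power2_eq_square)

text \<open>The convexity defect of a quadratic form between \<open>x\<close> and \<open>y\<close> is its value at \<open>x - y\<close>
  times \<open>t (1 - t)\<close>, and differences of points of the slice lie in the hyperplane
  \<open>u $ one = 0\<close>.\<close>

lemma quadratic_form_concave_on_slice:
  fixes W :: "real ^ 'k ^ 'k"
  assumes neg: "\<And>u. u $ one = 0 \<Longrightarrow> u \<bullet> (W *v u) \<le> 0"
  shows "concave_on {u. u $ one = 1} (\<lambda>u. u \<bullet> (W *v u))"
  unfolding concave_on_def
proof (rule convex_onI)
  fix t :: real and x y :: "real ^ 'k"
  assume t: "0 < t" "t < 1" and xy: "x \<in> {u. u $ one = 1}" "y \<in> {u. u $ one = 1}"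
  have "((1 - t) *\<^sub>R x + t *\<^sub>R y) \<bullet> (W *v ((1 - t) *\<^sub>R x + t *\<^sub>R y)) =
      (1 - t) * (x \<bullet> (W *v x)) + t * (y \<bullet> (W *v y))
        - t * (1 - t) * ((x - y) \<bullet> (W *v (x - y)))"
    by (simp add: matrix_vector_mult_scaleR matrix_vector_right_distrib
        matrix_vector_mult_diff_distrib inner_add_left inner_add_right inner_diff_left
        inner_diff_right) (simp add: algebra_simps)
  moreover have "t * (1 - t) * ((x - y) \<bullet> (W *v (x - y))) \<le> 0"
    using neg[of "x - y"] t xy by (intro mult_nonneg_nonpos) auto
  ultimately show "- (((1 - t) *\<^sub>R x + t *\<^sub>R y) \<bullet> (W *v ((1 - t) *\<^sub>R x + t *\<^sub>R y))) \<le>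
      (1 - t) * - (x \<bullet> (W *v x)) + t * - (y \<bullet> (W *v y))"
    by linarith
next
  show "convex {u :: real ^ 'k. u $ one = 1}"
    by (rule convexI) (simp add: algebra_simps)
qed

text \<open>The multipliers are found on the slice \<open>u $ one = 1\<close>. The inequality is homogeneous of
  degree two, so it extends to all \<open>u\<close> with \<open>u $ one \<noteq> 0\<close>; on the remaining hyperplane only
  the forms \<open>W j\<close> survive, and they are nonpositive there.\<close>

lemma affine_s_procedure:
  fixes W :: "nat \<Rightarrow> real ^ 'k ^ 'k" and c :: "real ^ 'k"
  assumes neg: "\<And>j u. u $ one = 0 \<Longrightarrow> u \<bullet> (W j *v u) \<le> 0"
    and z: "z \<in> uncertainty_set one l W" "\<forall>j\<in>{1..l}. 0 < z \<bullet> (W j *v z)"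
    and bound: "\<And>u. u \<in> uncertainty_set one l W \<Longrightarrow> t \<le> c \<bullet> u"
  shows "\<exists>\<nu>. (\<forall>j\<in>{1..l}. 0 \<le> \<nu> j) \<and>
    (\<forall>u. t * (u $ one)\<^sup>2 - u $ one * (c \<bullet> u) + (\<Sum>j\<in>{1..l}. \<nu> j * (u \<bullet> (W j *v u))) \<le> 0)"
proof -
  let ?D = "{u :: real ^ 'k. u $ one = 1}"
  have D: "convex ?D" by (rule convexI) (simp add: algebra_simps)
  have "\<exists>\<nu>. (\<forall>j\<in>{1..l}. 0 \<le> \<nu> j) \<and>
      (\<forall>u\<in>?D. (\<Sum>j\<in>{1..l}. \<nu> j * (u \<bullet> (W j *v u))) \<le> c \<bullet> u - t)"
  proof (rule lagrange_multipliers)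
    show "convex_on ?D (\<lambda>u. c \<bullet> u - t)"
      by (rule convex_onI) (auto simp: D inner_add_right algebra_simps)
    show "concave_on ?D (\<lambda>u. u \<bullet> (W j *v u))" for j
      using neg by (rule quadratic_form_concave_on_slice)
    show "z \<in> ?D" using z(1) by (simp add: uncertainty_set_def)
    show "0 \<le> c \<bullet> u - t" if "u \<in> ?D" "\<And>j. j \<in> {1..l} \<Longrightarrow> 0 \<le> u \<bullet> (W j *v u)" for u
      using bound[of u] that by (simp add: uncertainty_set_def)
  qed (use z in auto)
  then obtain \<nu> where \<nu>: "\<forall>j\<in>{1..l}. 0 \<le> \<nu> j"
      "\<And>u. u $ one = 1 \<Longrightarrow> (\<Sum>j\<in>{1..l}. \<nu> j * (u \<bullet> (W j *v u))) \<le> c \<bullet> u - t" by auto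
  have "t * (u $ one)\<^sup>2 - u $ one * (c \<bullet> u) + (\<Sum>j\<in>{1..l}. \<nu> j * (u \<bullet> (W j *v u))) \<le> 0" for u
  proof (cases "u $ one = 0")
    case True
    then have "(\<Sum>j\<in>{1..l}. \<nu> j * (u \<bullet> (W j *v u))) \<le> 0"
      using \<nu>(1) neg by (intro sum_nonpos mult_nonneg_nonpos) auto
    then show ?thesis using True by simp
  next
    case False
    define s where "s = u $ one"
    define y where "y = (1 / s) *\<^sub>R u"
    have s: "s \<noteq> 0" and u: "u = s *\<^sub>R y" and y: "y $ one = 1"
      using False by (auto simp: s_def y_def)
    have "t * (u $ one)\<^sup>2 - u $ one * (c \<bullet> u) + (\<Sum>j\<in>{1..l}. \<nu> j * (u \<bullet> (W j *v u)))
        = s\<^sup>2 * (t - c \<bullet> y + (\<Sum>j\<in>{1..l}. \<nu> j * (y \<bullet> (W j *v y))))"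
      unfolding u quadratic_form_scaleR
      using y by (simp add: sum_distrib_left algebra_simps power2_eq_square)
    also have "\<dots> \<le> 0"
      using \<nu>(2)[OF y] by (intro mult_nonneg_nonpos) auto
    finally show ?thesis .
  qed
  then show ?thesis using \<nu>(1) by blast
qed

text \<open>For \<open>u $ one = 0\<close> only the block $-\Omega^T \Omega$ contributes, which gives
  $-\|\Omega u\|^2$.\<close>

lemma ellipsoid_matrix_neg_on_hyperplane:
  fixes u :: "real ^ 'k"
  assumes "u $ one = 0"
  shows "u \<bullet> (ellipsoid_matrix one \<omega> w N \<Omega> *v u) \<le> 0"
proof -
  have "u \<bullet> (ellipsoid_matrix one \<omega> w N \<Omega> *v u) =
      (\<Sum>p\<in>UNIV. \<Sum>q\<in>UNIV. u $ p * (ellipsoid_matrix one \<omega> w N \<Omega> $ p $ q * u $ q))"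
    by (simp add: inner_vec_def matrix_vector_mult_def sum_distrib_left)
  also have "\<dots> = (\<Sum>p\<in>UNIV. \<Sum>q\<in>UNIV. u $ p * (- (\<Sum>r\<in>{1..N}. \<Omega> r $ p * \<Omega> r $ q) * u $ q))"
    using assms by (intro sum.cong) (auto simp: ellipsoid_matrix_def)
  also have "\<dots> = - (\<Sum>p\<in>UNIV. \<Sum>q\<in>UNIV. \<Sum>r\<in>{1..N}. (\<Omega> r $ p * u $ p) * (\<Omega> r $ q * u $ q))"
    by (simp add: sum_distrib_left sum_distrib_right sum_negf algebra_simps)
  also have "\<dots> = - (\<Sum>p\<in>UNIV. \<Sum>r\<in>{1..N}. \<Sum>q\<in>UNIV. (\<Omega> r $ p * u $ p) * (\<Omega> r $ q * u $ q))"
    by (subst (2) sum.swap) (rule refl)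
  also have "\<dots> = - (\<Sum>r\<in>{1..N}. \<Sum>p\<in>UNIV. \<Sum>q\<in>UNIV. (\<Omega> r $ p * u $ p) * (\<Omega> r $ q * u $ q))"
    by (subst sum.swap) (rule refl)
  also have "\<dots> = - (\<Sum>r\<in>{1..N}. (\<Omega> r \<bullet> u)\<^sup>2)"
    by (simp add: power2_eq_square inner_vec_def sum_product)
  also have "\<dots> \<le> 0" by (simp add: sum_nonneg)
  finally show ?thesis .
qed

lemma transpose_ellipsoid_matrix:
  "transpose (ellipsoid_matrix one \<omega> w N \<Omega>) = ellipsoid_matrix one \<omega> w N \<Omega>"
  by (auto simp: transpose_def ellipsoid_matrix_def vec_eq_iff mult.commute)

section \<open>Quadratic forms of complex matrices\<close>

lemma quad_form_eq_sum: "quad_form v X = (\<Sum>i\<in>UNIV. \<Sum>j\<in>UNIV. cnj (v $ i) * X $ i $ j * v $ j)"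
  by (simp add: quad_form_def matrix_vector_mult_def sum_distrib_left mult.assoc)

lemma quad_form_ctranspose: "quad_form v (ctranspose X) = cnj (quad_form v X)"
  unfolding quad_form_eq_sum
  by (subst sum.swap) (simp add: ctranspose_def mult_ac)

lemma quad_form_hermitian: "hermitian X \<Longrightarrow> Im (quad_form v X) = 0"
  by (metis quad_form_ctranspose hermitian_def Reals_cnj_iff complex_is_Real_iff)

lemma quad_form_uminus: "quad_form v (- X) = - quad_form v X"
  by (simp add: quad_form_eq_sum sum_negf)

lemma quad_form_herm_part: "quad_form v (herm_part X) = complex_of_real (Re (quad_form v X))"
proof -
  have "quad_form v (herm_part X) = (quad_form v X + quad_form v (ctranspose X)) / 2"
    by (simp add: quad_form_eq_sum herm_part_def sum_divide_distrib sum.distrib[symmetric]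
        algebra_simps add_divide_distrib)
  then show ?thesis
    by (simp add: quad_form_ctranspose complex_add_cnj)
qed

lemma quad_form_skew_part: "quad_form v (skew_part X) = complex_of_real (Im (quad_form v X))"
proof -
  have "quad_form v (skew_part X) = (quad_form v X - quad_form v (ctranspose X)) / (2 * \<i>)"
    by (simp add: quad_form_eq_sum skew_part_def sum_divide_distrib sum_subtractf[symmetric]
        algebra_simps diff_divide_distrib)
  also have "\<dots> = complex_of_real (Im (quad_form v X))"
    by (simp add: quad_form_ctranspose complex_diff_cnj) (simp add: complex_eq_iff)
  finally show ?thesis .
qed

lemma quad_form_outer_axis: "quad_form v (outer (axis i 1) (axis i 1)) = complex_of_real ((cmod (v $ i))\<^sup>2)"
proof -
  have "quad_form v (outer (axis i 1) (axis i 1)) =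
      (\<Sum>p\<in>UNIV. \<Sum>q\<in>UNIV. if p = i \<and> q = i then cnj (v $ i) * v $ i else 0)"
    unfolding quad_form_eq_sum
    by (intro sum.cong) (auto simp: outer_def axis_def)
  also have "\<dots> = cnj (v $ i) * v $ i"
  proof -
    have "(\<Sum>q\<in>UNIV. if p = i \<and> q = i then cnj (v $ i) * v $ i else 0)
        = (if p = i then cnj (v $ i) * v $ i else 0)" for p
      by (cases "p = i") auto
    then show ?thesis by simp
  qed
  finally show ?thesis
    by (metis complex_norm_square mult.commute of_real_power)
qed

text \<open>The form of a real symmetric matrix at \<open>x + \<i> y\<close> is the sum of its values at \<open>x\<close> and \<open>y\<close>, so
  it is enough to test real vectors.\<close>

lemma nsd_complex_mat:
  fixes R :: "real ^ 'k ^ 'k"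
  assumes sym: "transpose R = R" and neg: "\<And>u. u \<bullet> (R *v u) \<le> 0"
  shows "nsd (complex_mat R)"
proof -
  have "Re (quad_form v (complex_mat R)) = Re_vec v \<bullet> (R *v Re_vec v) + Im_vec v \<bullet> (R *v Im_vec v)"
    for v
    by (simp add: quad_form_eq_sum complex_mat_def inner_vec_def matrix_vector_mult_def
        Re_vec_def Im_vec_def sum_distrib_left sum.distrib[symmetric] algebra_simps)
  moreover have "R $ p $ q = R $ q $ p" for p q
    using sym by (metis transpose_def vec_lambda_beta)
  then have "hermitian (complex_mat R)"
    by (auto simp: hermitian_def ctranspose_def complex_mat_def vec_eq_iff)
  ultimately show ?thesis
    using neg[of "Re_vec v" for v] neg[of "Im_vec v" for v]
    by (auto simp: nsd_def intro: add_nonpos_nonpos)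
qed

lemma matrix_matrix_mult_add_rdistrib: "(A + B) ** C = A ** C + B ** C"
  for A B :: "'a::semiring_1 ^ 'n ^ 'm"
  by (simp add: vec_eq_iff matrix_matrix_mult_def distrib_right sum.distrib)

lemma majorizer_diagonal:
  "majorizer Apos Aneg V V = ctranspose V ** (Apos + Aneg) ** V"
  by (simp add: majorizer_def matrix_add_ldistrib matrix_matrix_mult_add_rdistrib)

text \<open>Tightness of the majorizer at a policy that does not react to the uncertainty. The matrix
  on the right is real because the form of a Hermitian matrix is.\<close>

lemma majorizer_outer_axis:
  assumes "hermitian (Apos + Aneg)"
  shows "majorizer Apos Aneg (outer v (axis one 1)) (outer v (axis one 1)) =
    complex_mat (Re (quad_form v (Apos + Aneg)) *\<^sub>R outer (axis one 1) (axis one 1))"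
proof -
  have "(ctranspose (outer v (axis one 1)) ** A ** outer v (axis one 1)) $ p $ q =
      (if p = one \<and> q = one then quad_form v A else 0)" for p q :: 'b and A :: "complex ^ 'a ^ 'a"
  proof -
    have "(ctranspose (outer v (axis one 1)) ** A ** outer v (axis one 1)) $ p $ q =
       (\<Sum>j\<in>UNIV. \<Sum>i\<in>UNIV. if p = one \<and> q = one then cnj (v $ i) * A $ i $ j * v $ j else 0)"
      by (simp add: matrix_matrix_mult_def ctranspose_def outer_def axis_def sum_distrib_right)
    also have "\<dots> = (if p = one \<and> q = one then quad_form v A else 0)"
      by (subst sum.swap) (auto simp: quad_form_eq_sum)
    finally show ?thesis .
  qed
  moreover have "quad_form v (Apos + Aneg) = complex_of_real (Re (quad_form v (Apos + Aneg)))"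
    using quad_form_hermitian[OF assms] by (simp add: complex_eq_iff)
  ultimately show ?thesis
    unfolding majorizer_diagonal
    by (auto simp: vec_eq_iff complex_mat_def outer_def axis_def)
qed

lemma hermitian_semidef_parts: "semidef_parts A Apos Aneg \<Longrightarrow> hermitian A"
  by (auto simp: semidef_parts_def psd_def nsd_def hermitian_def ctranspose_def vec_eq_iff)

lemma inner_outer_mult: "u \<bullet> (outer x y *v u) = (u \<bullet> x) * (u \<bullet> y)" for u :: "real ^ 'k"
proof -
  have "outer x y *v u = (u \<bullet> y) *\<^sub>R x"
    by (simp add: vec_eq_iff matrix_vector_mult_def outer_def inner_vec_def
        sum_distrib_left mult_ac)
  then show ?thesis by simp
qed

lemma matrix_vector_mult_sum_left:
  "(\<Sum>j\<in>J. X j) *v u = (\<Sum>j\<in>J. X j *v u)" for X :: "'b \<Rightarrow> real ^ 'k ^ 'n"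
  by (induction J rule: infinite_finite_induct) (auto simp: matrix_vector_mult_add_rdistrib)

text \<open>Robust counterpart of one constraint at the constant policy: a bound on the whole
  uncertainty set becomes a linear matrix inequality. The multipliers in the matrix inequality
  carry the sign opposite to those of the S-procedure.\<close>

lemma lmi_from_uncertainty_bound:
  fixes W :: "nat \<Rightarrow> real ^ 'k ^ 'k" and A :: "complex ^ 'n ^ 'n"
  assumes W: "W = (\<lambda>j. ellipsoid_matrix one (\<omega> j) (w j) (N j) (\<Omega> j))"
    and z: "z \<in> uncertainty_set one l W" "\<forall>j\<in>{1..l}. 0 < z \<bullet> (W j *v z)"
    and parts: "semidef_parts A Apos Aneg"
    and bound: "\<And>u. u \<in> uncertainty_set one l W \<Longrightarrow> Re (quad_form v A) + s \<le> c \<bullet> u"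
  shows "\<exists>\<kappa>. (\<forall>j\<in>{1..l}. \<kappa> j \<le> 0) \<and>
    nsd (majorizer Apos Aneg (outer v (axis one 1)) (outer v (axis one 1)) +
      complex_mat (- C_mat one c + s *\<^sub>R outer (axis one 1) (axis one 1)
        - (\<Sum>j\<in>{1..l}. \<kappa> j *\<^sub>R W j)))"
proof -
  let ?t = "Re (quad_form v A) + s" and ?e = "axis one (1 :: real)"
  obtain \<nu> where \<nu>: "\<forall>j\<in>{1..l}. 0 \<le> \<nu> j"
    "\<And>u. ?t * (u $ one)\<^sup>2 - u $ one * (c \<bullet> u) + (\<Sum>j\<in>{1..l}. \<nu> j * (u \<bullet> (W j *v u))) \<le> 0"
    using affine_s_procedure[OF _ z bound] ellipsoid_matrix_neg_on_hyperplane
    unfolding W by blast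
  define R where "R = - C_mat one c + ?t *\<^sub>R outer ?e ?e + (\<Sum>j\<in>{1..l}. \<nu> j *\<^sub>R W j)"
  have "nsd (complex_mat R)"
  proof (rule nsd_complex_mat)
    have "transpose (W j) = W j" for j
      by (simp add: W transpose_ellipsoid_matrix)
    then have "W j $ p $ q = W j $ q $ p" for j p q
      by (simp add: vec_eq_iff transpose_def)
    then show "transpose R = R"
      by (simp add: vec_eq_iff transpose_def R_def C_mat_def outer_def mult.commute add.commute)
    show "u \<bullet> (R *v u) \<le> 0" for u
    proof -
      have "u \<bullet> (R *v u) =
          ?t * (u $ one)\<^sup>2 - u $ one * (c \<bullet> u) + (\<Sum>j\<in>{1..l}. \<nu> j * (u \<bullet> (W j *v u)))"
        by (simp add: R_def C_mat_def matrix_vector_mult_add_rdistrib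
            matrix_vector_mult_diff_rdistrib inner_add_right inner_diff_right
            scaleR_matrix_vector_assoc[symmetric] inner_outer_mult inner_axis
            matrix_vector_mult_sum_left inner_sum_right power2_eq_square inner_commute
            algebra_simps)
      then show ?thesis using \<nu>(2)[of u] by simp
    qed
  qed
  moreover have A: "A = Apos + Aneg" using parts by (simp add: semidef_parts_def)
  have "majorizer Apos Aneg (outer v (axis one 1)) (outer v (axis one 1)) =
      complex_mat (Re (quad_form v A) *\<^sub>R outer ?e ?e)"
    using majorizer_outer_axis[of Apos Aneg v one] hermitian_semidef_parts[OF parts]
    unfolding A by blast
  then have "majorizer Apos Aneg (outer v (axis one 1)) (outer v (axis one 1)) +
      complex_mat (- C_mat one c + s *\<^sub>R outer ?e ?e - (\<Sum>j\<in>{1..l}. (- \<nu> j) *\<^sub>R W j))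
      = complex_mat R"
    by (simp add: R_def vec_eq_iff complex_mat_def sum_negf algebra_simps)
  ultimately show ?thesis
    using \<nu>(1) by (intro exI[of _ "\<lambda>j. - \<nu> j"]) auto
qed

section \<open>Feasibility of the zero-recourse dispatch\<close>

lemma Re_Im_vec_diff:
  "Re_vec (x - y) = Re_vec x - Re_vec y" "Im_vec (x - y) = Im_vec x - Im_vec y"
  by (simp_all add: Re_vec_def Im_vec_def vec_eq_iff)

lemma Re_Im_vec_axis:
  "Re_vec (a *s axis one 1) = Re a *s axis one 1" "Im_vec (a *s axis one 1) = Im a *s axis one 1"
  by (simp_all add: Re_vec_def Im_vec_def vec_eq_iff axis_def)

lemma inner_smult_axis: "(r *s axis one 1) \<bullet> u = r * u $ one" for u :: "real ^ 'k"
  by (simp add: scalar_mult_eq_scaleR inner_axis' del: vector_scalar_mult_def)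

lemma inner_row:
  "Re_vec (row i G) \<bullet> u = Re (gen_bound G u $ i)"
  "Im_vec (row i G) \<bullet> u = Im (gen_bound G u $ i)"
  by (simp_all add: row_def Re_vec_def Im_vec_def inner_vec_def gen_bound_def complex_vec_def
      matrix_vector_mult_def)

lemma axis_vector_matrix_mult: "axis i 1 v* G = row i G" for G :: "complex ^ 'k ^ 'n"
  by (simp add: vec_eq_iff vector_matrix_mult_def axis_def row_def if_distrib if_distribR
      cong: if_cong)

text \<open>Injection plus demand, split into active power (left summand) and reactive power (right
  summand) as in the vector \<open>x\<close> of the optimization problem.\<close>

definition generation :: "complex ^ 'n ^ 'n \<Rightarrow> complex ^ 'n \<Rightarrow> complex ^ 'n \<Rightarrow> real ^ ('n + 'n)" where
  "generation Y d v = (\<chi> r. case r of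
     Inl i \<Rightarrow> Re (quad_form v (S_bus Y i) + d $ i)
   | Inr i \<Rightarrow> Im (quad_form v (S_bus Y i) + d $ i))"

text \<open>The forms of \<open>Phi Y i\<close> and \<open>Psi Y i\<close> are the active and the reactive power injected
  at bus \<open>i\<close>, the real and imaginary parts of the form of \<open>S_bus Y i\<close>. In the four ramping
  triples the injection cancels against \<open>generation\<close> and leaves the sign conditions on the ramp limits.\<close>

lemma bus_triples_bound:
  fixes u :: "real ^ 'k" and v :: "complex ^ 'n"
  assumes triple: "(A, b, c) \<in># bus_triples one Y d Glow Gup rmin rmax vmin vmax i"
    and u: "u $ one = 1"
    and gen: "gen_bound Glow u $ i - d $ i \<le>\<^sub>C quad_form v (S_bus Y i)"
      "quad_form v (S_bus Y i) \<le>\<^sub>C gen_bound Gup u $ i - d $ i"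
    and ramp: "rmin $ i \<le>\<^sub>C 0" "0 \<le>\<^sub>C rmax $ i"
    and volt: "0 \<le> vmin $ i" "vmin $ i \<le> cmod (v $ i)" "cmod (v $ i) \<le> vmax $ i"
  shows "Re (quad_form v A) + b \<bullet> generation Y d v \<le> c \<bullet> u"
proof -
  have "(vmin $ i)\<^sup>2 \<le> (cmod (v $ i))\<^sup>2" "(cmod (v $ i))\<^sup>2 \<le> (vmax $ i)\<^sup>2"
    using volt by (auto intro!: power_mono)
  then show ?thesis
    using triple gen ramp u
    by (auto simp: bus_triples_def quad_form_uminus Phi_def Psi_def quad_form_herm_part
        quad_form_skew_part quad_form_outer_axis Re_Im_vec_diff Re_Im_vec_axis inner_diff_left
        inner_smult_axis axis_vector_matrix_mult inner_row inner_axis' generation_def complex_le_def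
        simp del: vector_scalar_mult_def)
qed

lemma line_triples_bound:
  fixes u :: "real ^ 'k" and v :: "complex ^ 'n"
  assumes triple: "(A, b, c) \<in># line_triples one Y yhat lmax i j"
    and u: "u $ one = 1"
    and flow: "- complex_of_real (lmax i j) \<le>\<^sub>C quad_form v (P_line Y yhat i j)"
      "quad_form v (P_line Y yhat i j) \<le>\<^sub>C complex_of_real (lmax i j)"
  shows "Re (quad_form v A) + b \<bullet> x \<le> c \<bullet> u"
  using triple flow u
  by (auto simp: line_triples_def quad_form_uminus inner_smult_axis complex_le_def
      simp del: vector_scalar_mult_def)

lemma generation_nameplate:
  fixes v :: "complex ^ 'n::finite"
  assumes "\<And>i. gmin $ i \<le>\<^sub>C quad_form v (S_bus Y i) + d $ i"
    and "\<And>i. quad_form v (S_bus Y i) + d $ i \<le>\<^sub>C gmax $ i"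
  shows "E_mat *v generation Y d v \<le> f_vec gmin gmax"
proof -
  have "(E_mat *v x) $ r = (case r of Inl p \<Rightarrow> x $ p | Inr p \<Rightarrow> - x $ p)"
    for x :: "real ^ ('n + 'n)" and r
  proof -
    have "(E_mat *v x) $ r = E_mat $ r \<bullet> x"
      by (simp add: matrix_vector_mul_component)
    then show ?thesis
      by (cases r) (simp_all add: E_mat_def inner_axis')
  qed
  then show ?thesis
    using assms unfolding complex_le_def
    by (auto simp: less_eq_vec_def generation_def f_vec_def algebra_simps split: sum.splits)
qed

text \<open>The nameplate bounds keep the ranges bounded, so that the suprema and infima are
  genuine.\<close>

lemma gamma_bounds:
  assumes z: "z \<in> \<Xi>"
    and bounds: "\<And>z i. z \<in> \<Xi> \<Longrightarrow> gmin $ i \<le>\<^sub>C gen_bound G z $ i \<and> gen_bound G z $ i \<le>\<^sub>C gmax $ i"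
  shows "gen_bound G z $ i \<le>\<^sub>C gamma_min \<Xi> G i" "gamma_max \<Xi> G i \<le>\<^sub>C gen_bound G z $ i"
proof -
  have "bdd_above ((\<lambda>z. Re (gen_bound G z $ i)) ` \<Xi>)" "bdd_above ((\<lambda>z. Im (gen_bound G z $ i)) ` \<Xi>)"
    "bdd_below ((\<lambda>z. Re (gen_bound G z $ i)) ` \<Xi>)" "bdd_below ((\<lambda>z. Im (gen_bound G z $ i)) ` \<Xi>)"
    using bounds unfolding complex_le_def by (meson bdd_aboveI2 bdd_belowI2)+
  then show "gen_bound G z $ i \<le>\<^sub>C gamma_min \<Xi> G i" "gamma_max \<Xi> G i \<le>\<^sub>C gen_bound G z $ i"
    using z
    by (auto simp: complex_le_def gamma_min_def gamma_max_def intro!: cSUP_upper cINF_lower)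
qed

lemma complex_le_trans [trans]: "a \<le>\<^sub>C b \<Longrightarrow> b \<le>\<^sub>C c \<Longrightarrow> a \<le>\<^sub>C c"
  by (auto simp: complex_le_def)

theorem proposition2:
  fixes \<mu> :: "'w measure" and \<xi> :: "'w \<Rightarrow> real ^ 'k" and M :: "real ^ 'k ^ 'k"
    and one :: "'k::finite"
    and l :: nat and N :: "nat \<Rightarrow> nat"
    and \<omega> :: "nat \<Rightarrow> real" and w :: "nat \<Rightarrow> real ^ 'k" and \<Omega> :: "nat \<Rightarrow> nat \<Rightarrow> real ^ 'k"
    and W :: "nat \<Rightarrow> real ^ 'k ^ 'k" and \<Xi> :: "(real ^ 'k) set"
    and Lines :: "('n::finite \<times> 'n) set"
    and Y :: "complex ^ 'n ^ 'n" and yhat :: "'n \<Rightarrow> 'n \<Rightarrow> complex"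
    and \<alpha> :: "real ^ 'n" and d :: "complex ^ 'n"
    and gmin gmax rmin rmax :: "complex ^ 'n"
    and vmin vmax :: "real ^ 'n" and lmax :: "'n \<Rightarrow> 'n \<Rightarrow> real"
    and Glow Gup :: "complex ^ 'k ^ 'n"
    and m :: nat
    and A Apos Aneg :: "nat \<Rightarrow> complex ^ 'n ^ 'n"
    and b :: "nat \<Rightarrow> real ^ ('n + 'n)" and c :: "nat \<Rightarrow> real ^ 'k"
    and v\<^sub>0 :: "complex ^ 'n" and V\<^sub>0 :: "complex ^ 'k ^ 'n"
  assumes prob: "prob_space \<mu>"
    and rv: "\<xi> \<in> borel_measurable \<mu>"
    and M: "M = second_moment \<mu> \<xi>"
    and W: "W = (\<lambda>j. ellipsoid_matrix one (\<omega> j) (w j) (N j) (\<Omega> j))"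
    and Xi: "\<Xi> = uncertainty_set one l W"
    and supp: "rv_support \<mu> \<xi> = \<Xi>"
    and Xi_nonempty: "\<Xi> \<noteq> {}"
    and Xi_compact: "compact \<Xi>"
    and slater: "\<exists>z\<in>\<Xi>. \<forall>j\<in>{1..l}. 0 < z \<bullet> (W j *v z)"
    and lines: "\<And>i j. (i, j) \<in> Lines \<longleftrightarrow> (j, i) \<in> Lines"
    and alpha: "\<And>i. 0 \<le> \<alpha> $ i"
    and ramp: "\<And>i. rmin $ i \<le>\<^sub>C 0 \<and> 0 \<le>\<^sub>C rmax $ i"
    and voltage: "\<And>i. 0 \<le> vmin $ i"
    and capacity: "\<And>z i. z \<in> \<Xi> \<Longrightarrow>
        gmin $ i \<le>\<^sub>C gen_bound Glow z $ i \<and>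
        gen_bound Glow z $ i \<le>\<^sub>C gen_bound Gup z $ i \<and>
        gen_bound Gup z $ i \<le>\<^sub>C gmax $ i"
    and A0: "A 0 = (\<Sum>i\<in>UNIV. \<alpha> $ i *\<^sub>R Phi Y i)"
    and m: "m = 10 * CARD('n) + 2 * card Lines"
    and data: "image_mset (\<lambda>i. (A i, b i, c i)) (mset_set {1..m}) =
        (\<Sum>i\<in>UNIV. bus_triples one Y d Glow Gup rmin rmax vmin vmax i)
        + (\<Sum>(i, j)\<in>Lines. line_triples one Y yhat lmax i j)"
    and parts: "\<And>i. i \<le> m \<Longrightarrow> semidef_parts (A i) (Apos i) (Aneg i)"
    and v0: "v\<^sub>0 \<in> feasible_region (zero_recourse Y yhat Lines \<alpha> d
        (gamma_min \<Xi> Glow) (gamma_max \<Xi> Gup) vmin vmax lmax)"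
    and V0: "V\<^sub>0 = outer v\<^sub>0 (axis one 1)"
  shows "feasible_region (P_III one m l M W Apos Aneg b c gmin gmax V\<^sub>0) \<noteq> {}"
proof -
  obtain z where z: "z \<in> uncertainty_set one l W" "\<forall>j\<in>{1..l}. 0 < z \<bullet> (W j *v z)"
    using slater unfolding Xi by blast
  let ?q = "\<lambda>i. quad_form v\<^sub>0 (S_bus Y i)"
  have feas: "gamma_min \<Xi> Glow i - d $ i \<le>\<^sub>C ?q i" "?q i \<le>\<^sub>C gamma_max \<Xi> Gup i - d $ i"
    "vmin $ i \<le> cmod (v\<^sub>0 $ i)" "cmod (v\<^sub>0 $ i) \<le> vmax $ i" for i
    using v0 unfolding zero_recourse_def by auto
  have flow: "- complex_of_real (lmax i j) \<le>\<^sub>C quad_form v\<^sub>0 (P_line Y yhat i j)"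
    "quad_form v\<^sub>0 (P_line Y yhat i j) \<le>\<^sub>C complex_of_real (lmax i j)" if "(i, j) \<in> Lines" for i j
    using v0 that unfolding zero_recourse_def by auto
  have low_gamma: "gen_bound Glow u $ i \<le>\<^sub>C gamma_min \<Xi> Glow i" if "u \<in> \<Xi>" for u i
    using that capacity by (intro gamma_bounds(1)[where gmin = gmin and gmax = gmax])
      (auto intro: complex_le_trans)
  have low: "gen_bound Glow u $ i - d $ i \<le>\<^sub>C ?q i" if "u \<in> \<Xi>" for u i
    using low_gamma[OF that, of i] feas(1)[of i] by (simp add: complex_le_def)
  have up_gamma: "gamma_max \<Xi> Gup i \<le>\<^sub>C gen_bound Gup u $ i" if "u \<in> \<Xi>" for u i
    using that capacity by (intro gamma_bounds(2)[where gmin = gmin and gmax = gmax])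
      (auto intro: complex_le_trans)
  have up: "?q i \<le>\<^sub>C gen_bound Gup u $ i - d $ i" if "u \<in> \<Xi>" for u i
    using up_gamma[OF that, of i] feas(2)[of i] by (simp add: complex_le_def)
  have bound: "Re (quad_form v\<^sub>0 (A i)) + b i \<bullet> generation Y d v\<^sub>0 \<le> c i \<bullet> u"
    if i: "i \<in> {1..m}" and u: "u \<in> \<Xi>" for i u
  proof -
    have "(A i, b i, c i) \<in># image_mset (\<lambda>i. (A i, b i, c i)) (mset_set {1..m})"
      using i by auto
    then consider h where "(A i, b i, c i) \<in># bus_triples one Y d Glow Gup rmin rmax vmin vmax h"
      | h k where "(h, k) \<in> Lines" "(A i, b i, c i) \<in># line_triples one Y yhat lmax h k"
      unfolding data by (auto simp: set_mset_sum)
    moreover have "u $ one = 1" using u by (simp add: Xi uncertainty_set_def)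
    ultimately show ?thesis
    proof cases
      case 1
      then show ?thesis
        using bus_triples_bound[OF 1 \<open>u $ one = 1\<close> low[OF u] up[OF u]] ramp voltage feas
        by blast
    next
      case 2
      then show ?thesis
        using line_triples_bound[OF 2(2) \<open>u $ one = 1\<close> flow[OF 2(1)]] by blast
    qed
  qed
  let ?feas = "\<lambda>i \<kappa>. (\<forall>j\<in>{1..l}. \<kappa> j \<le> 0) \<and>
      nsd (majorizer (Apos i) (Aneg i) V\<^sub>0 V\<^sub>0 +
        complex_mat (- C_mat one (c i)
          + (b i \<bullet> generation Y d v\<^sub>0) *\<^sub>R outer (axis one 1) (axis one 1)
          - (\<Sum>j\<in>{1..l}. \<kappa> j *\<^sub>R W j)))"
  have "\<forall>i\<in>{1..m}. \<exists>\<kappa>. ?feas i \<kappa>"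
    unfolding V0 using bound unfolding Xi
    by (intro ballI lmi_from_uncertainty_bound[OF W z parts]) auto
  from bchoice[OF this] obtain \<kappa> where \<kappa>: "\<forall>i\<in>{1..m}. ?feas i (\<kappa> i)" ..
  \<comment> \<open>Entries outside the \<open>m\<close> by \<open>l\<close> block have to vanish.\<close>
  define \<Lambda> where "\<Lambda> = (\<lambda>i j. if i \<in> {1..m} \<and> j \<in> {1..l} then \<kappa> i j else 0)"
  have \<Lambda>_sum: "(\<Sum>j\<in>{1..l}. \<Lambda> i j *\<^sub>R W j) = (\<Sum>j\<in>{1..l}. \<kappa> i j *\<^sub>R W j)" if "i \<in> {1..m}" for i
    using that by (intro sum.cong) (auto simp: \<Lambda>_def)
  have "E_mat *v generation Y d v\<^sub>0 \<le> f_vec gmin gmax"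
  proof (rule generation_nameplate)
    have "z \<in> \<Xi>" using z(1) Xi by simp
    then show "gmin $ i \<le>\<^sub>C ?q i + d $ i" "?q i + d $ i \<le>\<^sub>C gmax $ i" for i
      using low[of z i] up[of z i] capacity[of z i] by (auto simp: complex_le_def)
  qed
  then have "(generation Y d v\<^sub>0, V\<^sub>0, \<Lambda>) \<in>
      feasible_region (P_III one m l M W Apos Aneg b c gmin gmax V\<^sub>0)"
    using \<kappa> by (simp add: P_III_def \<Lambda>_sum) (auto simp: \<Lambda>_def)
  then show ?thesis by blast
qed

end
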